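(* Let $d\ge 1$, $n\ge 3$, $1<j<n$, and let $H$ be a self-transpose $d\times d$ Hadamard matrix satisfying the extended calculus, i.e. such that for all $a,b,c\in\{0,\dots,d-1\}$ $$\sum_{r=0}^{d-1}\overline{H}_{a,r}H_{b,r}H_{c,r}=\sqrt d\;\overline{H}_{a,b}\overline{H}_{a,c}H_{b,c}.$$ Apply to the $n$-partite cluster chain $|\mathrm{C}_n\rangle\in(\mathbb{C}^d)^{\otimes n}$ first the 1-qudit gate $H$ on qudit $j$, and then the 2-qudit gates $Z_{j-1,j}$ and $Z_{j,j+1}$. The resulting state is, up to a nonzero scalar factor, a cluster chain of length $n-1$ on the qudits $1,\dots,j-1,j+1,\dots,n$ (in this order) tensored with the (unnormalized) $|+\rangle$ state on qudit $j$, i.e. $$\sum_{a_1,\dots,a_n=0}^{d-1}\Big(\prod_{i=1}^{j-2}\overline{H}_{a_i,a_{i+1}}\Big)\,\overline{H}_{a_{j-1},a_{j+1}}\,\Big(\prod_{i=j+1}^{n-1}\overline{H}_{a_i,a_{i+1}}\Big)\,|a_1\cdots a_n\rangle .$$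
   Context: A Hadamard matrix here is a unitary matrix all of whose entries have the same absolute value; self-transpose means $H_{a,b}=H_{b,a}$. The $m$-partite cluster chain associated to $H$ is $$|\mathrm{C}_m\rangle=\sum_{a_1,\dots,a_m=0}^{d-1}\overline{H}_{a_1,a_2}\cdots\overline{H}_{a_{m-1},a_m}\,|a_1\cdots a_m\rangle .$$ The 1-qudit gate is the linear map on $\mathbb{C}^d$ with matrix $H$. The 2-qudit gate $Z_{i,j}$ acts on qudits $i,j$ as the diagonal unitary $|a\rangle_i|b\rangle_j\mapsto\sqrt d\,\overline{H}_{a,b}|a\rangle_i|b\rangle_j$ and as the identity on the other qudits. Empty products equal $1$. *)

theory Defs
  imports Complex_Main "HOL-Library.FuncSet" "Jordan_Normal_Form.Schur_Decomposition"
begin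

definition unitary_mat :: "nat \<Rightarrow> complex mat \<Rightarrow> bool" where
  "unitary_mat d U \<longleftrightarrow> U \<in> carrier_mat d d \<and>
     mat_adjoint U * U = 1\<^sub>m d \<and> U * mat_adjoint U = 1\<^sub>m d"

definition hadamard_mat :: "nat \<Rightarrow> complex mat \<Rightarrow> bool" where
  "hadamard_mat d H \<longleftrightarrow> unitary_mat d H \<and>
     (\<forall>a<d. \<forall>b<d. \<forall>a'<d. \<forall>b'<d. cmod (H $$ (a, b)) = cmod (H $$ (a', b')))"

definition extended_calculus :: "nat \<Rightarrow> complex mat \<Rightarrow> bool" where
  "extended_calculus d H \<longleftrightarrow> (\<forall>a<d. \<forall>b<d. \<forall>c<d.
     (\<Sum>r<d. cnj (H $$ (a, r)) * H $$ (b, r) * H $$ (c, r)) =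
       complex_of_real (sqrt (real d)) * cnj (H $$ (a, b)) * cnj (H $$ (a, c)) * H $$ (b, c))"

text \<open>
  Qudits are labelled by natural numbers. For a finite set Q of qudits, the computational basis
  of the state space of Q is indexed by the assignments of a value in {0, ..., d - 1} to every
  qudit of Q. A state is given by its amplitude function, which vanishes outside these labels;
  sums and scalar multiples of states are pointwise.
\<close>

type_synonym label = "nat \<Rightarrow> nat"
type_synonym state = "label \<Rightarrow> complex"

definition labels :: "nat \<Rightarrow> nat set \<Rightarrow> label set" where
  "labels d Q = Q \<rightarrow>\<^sub>E {..<d}"

definition ket :: "label \<Rightarrow> state" where
  "ket a = (\<lambda>x. if x = a then 1 else 0)"

definition scale_state :: "complex \<Rightarrow> state \<Rightarrow> state" where
  "scale_state c \<psi> = (\<lambda>x. c * \<psi> x)"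

definition superposition :: "nat \<Rightarrow> nat set \<Rightarrow> (label \<Rightarrow> complex) \<Rightarrow> state" where
  "superposition d Q f = (\<lambda>x. \<Sum>a\<in>labels d Q. f a * ket a x)"

text \<open>
  The linear map on the states of Q that sends each basis vector \<open>ket a\<close> to \<open>g a\<close>.
\<close>

definition linear_extension :: "nat \<Rightarrow> nat set \<Rightarrow> (label \<Rightarrow> state) \<Rightarrow> state \<Rightarrow> state" where
  "linear_extension d Q g \<psi> = (\<lambda>x. \<Sum>a\<in>labels d Q. \<psi> a * g a x)"

definition gate1 :: "nat \<Rightarrow> nat set \<Rightarrow> complex mat \<Rightarrow> nat \<Rightarrow> state \<Rightarrow> state" where
  "gate1 d Q M j = linear_extension d Q
     (\<lambda>a x. \<Sum>r<d. M $$ (r, a j) * ket (a(j := r)) x)"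

definition gateZ :: "nat \<Rightarrow> nat set \<Rightarrow> complex mat \<Rightarrow> nat \<Rightarrow> nat \<Rightarrow> state \<Rightarrow> state" where
  "gateZ d Q H i k = linear_extension d Q
     (\<lambda>a. scale_state (complex_of_real (sqrt (real d)) * cnj (H $$ (a i, a k))) (ket a))"

text \<open>
  The cluster chain on the qudits listed in \<open>qs\<close>, taken in that order (list positions start
  at 0).
\<close>

definition cluster_chain :: "nat \<Rightarrow> complex mat \<Rightarrow> nat list \<Rightarrow> state" where
  "cluster_chain d H qs = superposition d (set qs)
     (\<lambda>a. \<Prod>i<length qs - 1. cnj (H $$ (a (qs ! i), a (qs ! Suc i))))"

definition plus_state :: "nat \<Rightarrow> nat \<Rightarrow> state" where
  "plus_state d j = superposition d {j} (\<lambda>a. 1)"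

text \<open>
  The tensor product of a state of P and a state of Q, for disjoint P and Q, as a state of
  \<open>P \<union> Q\<close>.
\<close>

definition tensor_state :: "nat \<Rightarrow> nat set \<Rightarrow> nat set \<Rightarrow> state \<Rightarrow> state \<Rightarrow> state" where
  "tensor_state d P Q \<phi> \<psi> =
     superposition d (P \<union> Q) (\<lambda>a. \<phi> (restrict a P) * \<psi> (restrict a Q))"

end

theory Submission
  imports Defs
begin

text \<open>
  At a label \<open>x\<close> the Hadamard gate on qudit \<open>j\<close> replaces the two chain factors at \<open>j\<close> by a sum
  over the old value \<open>r\<close> of qudit \<open>j\<close>, and the conjugate of the extended calculus evaluates it to
  \<open>sqrt d * H(x\<^sub>j, x\<^bsub>j-1\<^esub>) * H(x\<^sub>j, x\<^bsub>j+1\<^esub>) * cnj H(x\<^bsub>j-1\<^esub>, x\<^bsub>j+1\<^esub>)\<close>. The two diagonal gates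
  cancel the phases of the first two factors, since all entries have modulus \<open>1 / sqrt d\<close>; what
  remains is the shortened chain with the scalar \<open>1 / sqrt d\<close>.
\<close>

lemma finite_labels [simp]: "finite Q \<Longrightarrow> finite (labels d Q)"
  by (simp add: labels_def finite_PiE)

lemma label_less: "a \<in> labels d Q \<Longrightarrow> i \<in> Q \<Longrightarrow> a i < d"
  by (auto simp: labels_def PiE_def Pi_def)

lemma fun_upd_in_labels: "a \<in> labels d Q \<Longrightarrow> j \<in> Q \<Longrightarrow> r < d \<Longrightarrow> a(j := r) \<in> labels d Q"
  by (auto simp: labels_def PiE_def Pi_def extensional_def)

lemma restrict_in_labels: "a \<in> labels d Q \<Longrightarrow> P \<subseteq> Q \<Longrightarrow> restrict a P \<in> labels d P"
  by (auto simp: labels_def PiE_def Pi_def)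

lemma superposition_apply:
  assumes "finite Q"
  shows "superposition d Q f x = (if x \<in> labels d Q then f x else 0)"
  using assms by (simp add: superposition_def ket_def if_distrib sum.delta' cong: if_cong)

lemma superposition_cong:
  "(\<And>a. a \<in> labels d Q \<Longrightarrow> f a = g a) \<Longrightarrow> superposition d Q f = superposition d Q g"
  by (simp add: superposition_def)

lemma gateZ_apply:
  assumes "finite Q"
  shows "gateZ d Q H i k \<psi> x =
    (if x \<in> labels d Q
     then complex_of_real (sqrt (real d)) * cnj (H $$ (x i, x k)) * \<psi> x else 0)"
  using assms
  by (simp add: gateZ_def linear_extension_def scale_state_def ket_def if_distrib sum.delta'
      mult_ac cong: if_cong)

text \<open>\<open>gate1\<close> is given by the images of the kets, that is by the columns of
  \<open>M\<close>. The amplitude at \<open>x\<close> collects the labels that agree with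
  \<open>x\<close> off \<open>j\<close>; these are exactly \<open>x(j := r)\<close> with
  \<open>r < d\<close>, so row \<open>x j\<close> of \<open>M\<close> is applied to the old values
  of qudit \<open>j\<close>.\<close>

lemma gate1_apply:
  assumes "finite Q" "j \<in> Q"
  shows "gate1 d Q M j \<psi> x =
    (if x \<in> labels d Q then \<Sum>r<d. M $$ (x j, r) * \<psi> (x(j := r)) else 0)"
proof (cases "x \<in> labels d Q")
  case True
  have inner: "(\<Sum>r<d. M $$ (r, a j) * ket (a(j := r)) x) =
      (if a(j := x j) = x then M $$ (x j, a j) else 0)" for a
  proof -
    have "(\<Sum>r<d. M $$ (r, a j) * ket (a(j := r)) x) =
        (\<Sum>r<d. if r = x j then (if a(j := x j) = x then M $$ (x j, a j) else 0) else 0)"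
      by (rule sum.cong) (auto simp: ket_def fun_upd_same)
    then show ?thesis
      using label_less[OF True assms(2)] by simp
  qed
  have line: "{a \<in> labels d Q. a(j := x j) = x} = (\<lambda>r. x(j := r)) ` {..<d}"
  proof (intro equalityI subsetI)
    fix a assume a: "a \<in> {a \<in> labels d Q. a(j := x j) = x}"
    then have "a = x(j := a j)" by (metis (mono_tags, lifting) fun_upd_triv fun_upd_upd mem_Collect_eq)
    then show "a \<in> (\<lambda>r. x(j := r)) ` {..<d}"
      using a assms(2) label_less by blast
  qed (auto intro: fun_upd_in_labels[OF True assms(2)])
  have inj: "inj_on (\<lambda>r. x(j := r)) {..<d}"
    by (auto simp: inj_on_def dest: fun_upd_eqD)
  have "gate1 d Q M j \<psi> x =
      (\<Sum>a\<in>labels d Q. if a(j := x j) = x then \<psi> a * M $$ (x j, a j) else 0)"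
    unfolding gate1_def linear_extension_def inner by (rule sum.cong) auto
  also have "\<dots> = (\<Sum>a\<in>{a \<in> labels d Q. a(j := x j) = x}. \<psi> a * M $$ (x j, a j))"
    using assms(1) by (simp add: sum.inter_filter)
  also have "\<dots> = (\<Sum>r<d. M $$ (x j, r) * \<psi> (x(j := r)))"
    unfolding line by (simp add: sum.reindex[OF inj] mult.commute)
  finally show ?thesis using True by simp
next
  case False
  \<comment> \<open>Changing a label at \<open>j\<close> to a value below \<open>d\<close> gives a
    label again, so no ket in the image reaches this \<open>x\<close>.\<close>
  have "ket (a(j := r)) x = 0" if "a \<in> labels d Q" "r < d" for a r
    using fun_upd_in_labels[OF that(1) assms(2) that(2)] False by (auto simp: ket_def)
  then show ?thesis
    using False by (simp add: gate1_def linear_extension_def)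
qed

text \<open>Both restrictions of a label of \<open>P \<union> Q\<close> are labels themselves, so
  the default value 0 of the two factors is never read.\<close>

lemma tensor_superposition:
  assumes "finite P" "finite Q"
  shows "tensor_state d P Q (superposition d P f) (superposition d Q g) =
    superposition d (P \<union> Q) (\<lambda>a. f (restrict a P) * g (restrict a Q))"
  unfolding tensor_state_def
  by (rule superposition_cong) (simp add: superposition_apply assms restrict_in_labels)

text \<open>A pair of neighbours lies in \<open>xs\<close>, lies in \<open>ys\<close> or straddles
  the joint. The joint is the new bond when qudit \<open>j\<close> is cut out of the chain, and a
  bond at \<open>j\<close> when the full chain is split around \<open>j\<close>.\<close>

lemma prod_consecutive_append:
  fixes g :: "'a \<Rightarrow> 'a \<Rightarrow> 'b :: comm_monoid_mult"
  assumes "xs \<noteq> []" "ys \<noteq> []"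
  shows "(\<Prod>i<length (xs @ ys) - 1. g ((xs @ ys) ! i) ((xs @ ys) ! Suc i)) =
    (\<Prod>i<length xs - 1. g (xs ! i) (xs ! Suc i)) * g (last xs) (hd ys) *
    (\<Prod>i<length ys - 1. g (ys ! i) (ys ! Suc i))"
  using assms(1)
proof (induction xs)
  case (Cons x xs)
  show ?case
  proof (cases "xs = []")
    case True
    obtain y zs where "ys = y # zs" using assms(2) by (cases ys) auto
    then show ?thesis using True by (simp add: prod.lessThan_Suc_shift del: prod.lessThan_Suc)
  next
    case False
    obtain z zs where z: "xs = z # zs" using False by (cases xs) auto
    show ?thesis using Cons.IH[OF False]
      by (simp add: z prod.lessThan_Suc_shift mult.assoc del: prod.lessThan_Suc)
  qed
qed simp

lemma prod_consecutive_upt: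
  fixes g :: "nat \<Rightarrow> nat \<Rightarrow> 'b :: comm_monoid_mult"
  shows "(\<Prod>i<length [m..<n] - 1. g ([m..<n] ! i) ([m..<n] ! Suc i)) =
    (\<Prod>i = m..<n - 1. g i (i + 1))"
proof -
  have "(\<Prod>i<length [m..<n] - 1. g ([m..<n] ! i) ([m..<n] ! Suc i)) =
      (\<Prod>i = 0..<n - 1 - m. g (i + m) (i + m + 1))"
    by (rule prod.cong) (auto simp: add.commute)
  also have "\<dots> = (\<Prod>i = m..<n - 1. g i (i + 1))"
  \<comment> \<open>In the other case truncated subtraction makes both products empty.\<close>
  proof (cases "m \<le> n - 1")
    case True
    then have "0 + m = m" "n - 1 - m + m = n - 1" by simp_all
    then show ?thesis
      using prod.shift_bounds_nat_ivl[of "\<lambda>i. g i (i + 1)" 0 m "n - 1 - m"] by metis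
  qed simp
  finally show ?thesis .
qed

text \<open>The diagonal entry \<open>(a, a)\<close> of \<open>H * mat_adjoint H\<close> is 1, and
  it is a sum of \<open>d\<close> squared moduli, all equal.\<close>

lemma hadamard_entry_norm:
  assumes "hadamard_mat d H" "a < d" "b < d"
  shows "H $$ (a, b) * cnj (H $$ (a, b)) = 1 / of_nat d"
proof -
  have H: "H \<in> carrier_mat d d" "H * mat_adjoint H = 1\<^sub>m d"
    using assms(1) by (auto simp: hadamard_mat_def unitary_mat_def)
  have flat: "H $$ (a, r) * cnj (H $$ (a, r)) = H $$ (a, b) * cnj (H $$ (a, b))" if "r < d" for r
    using assms that unfolding hadamard_mat_def complex_norm_square[symmetric] by metis
  have "1 = (H * mat_adjoint H) $$ (a, a)"
    using H assms(2) by simp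
  also have "\<dots> = (\<Sum>r<d. H $$ (a, r) * cnj (H $$ (a, r)))"
    using H(1) assms(2)
    by (simp add: mat_adjoint_def mat_of_rows_index scalar_prod_def atLeast0LessThan)
  also have "\<dots> = of_nat d * (H $$ (a, b) * cnj (H $$ (a, b)))"
    using flat by simp
  finally show ?thesis
    using assms(2) by (simp add: field_simps)
qed

text \<open>This is the computation at a single label, without the chain factors away from
  \<open>j\<close>: \<open>p\<close> and \<open>q\<close> are the values of the qudits
  \<open>j - 1\<close> and \<open>j + 1\<close>, \<open>r\<close> and \<open>t\<close> those of
  qudit \<open>j\<close> before and after the gate \<open>H\<close>.\<close>

lemma extended_calculus_contract:
  assumes "hadamard_mat d H" "transpose_mat H = H" "extended_calculus d H"
    and "p < d" "q < d" "t < d"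
  shows "complex_of_real (sqrt (real d)) * cnj (H $$ (t, q)) *
      (complex_of_real (sqrt (real d)) * cnj (H $$ (p, t)) *
        (\<Sum>r<d. H $$ (t, r) * (cnj (H $$ (p, r)) * cnj (H $$ (r, q))))) =
    1 / complex_of_real (sqrt (real d)) * cnj (H $$ (p, q))"
proof -
  let ?s = "complex_of_real (sqrt (real d))"
  have dim: "H \<in> carrier_mat d d"
    using assms(1) by (auto simp: hadamard_mat_def unitary_mat_def)
  have sym: "H $$ (u, v) = H $$ (v, u)" if "u < d" "v < d" for u v
    using index_transpose_mat(1)[of u H v] assms(2) dim that by auto
  have d: "d > 0" using assms(4) by simp
  have s2: "?s * ?s = of_nat d"
    by (simp flip: of_real_mult)
  \<comment> \<open>The extended calculus is used at the triple \<open>t\<close>, \<open>p\<close>,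
    \<open>q\<close>; symmetry moves the index \<open>r\<close> to the second place.\<close>
  have "(\<Sum>r<d. H $$ (t, r) * (cnj (H $$ (p, r)) * cnj (H $$ (r, q)))) =
      cnj (\<Sum>r<d. cnj (H $$ (t, r)) * H $$ (p, r) * H $$ (q, r))"
    unfolding cnj_sum by (rule sum.cong) (auto simp: sym[of _ q] assms(5) mult.assoc)
  also have "\<dots> = ?s * H $$ (t, p) * H $$ (t, q) * cnj (H $$ (p, q))"
    using assms(3-) by (simp add: extended_calculus_def)
  finally have S: "(\<Sum>r<d. H $$ (t, r) * (cnj (H $$ (p, r)) * cnj (H $$ (r, q)))) =
      ?s * H $$ (t, p) * H $$ (t, q) * cnj (H $$ (p, q))" .
  \<comment> \<open>Regrouping pairs two entries with their conjugates, each pair worth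
    \<open>1 / of_nat d\<close>. Against three factors \<open>?s\<close> this leaves
    \<open>1 / ?s\<close>.\<close>
  have "?s * cnj (H $$ (t, q)) * (?s * cnj (H $$ (p, t)) *
        (\<Sum>r<d. H $$ (t, r) * (cnj (H $$ (p, r)) * cnj (H $$ (r, q))))) =
      (?s * ?s) * ?s * (H $$ (t, p) * cnj (H $$ (t, p))) * (H $$ (t, q) * cnj (H $$ (t, q))) *
        cnj (H $$ (p, q))"
    unfolding S using sym[OF assms(4,6)] by (simp only: mult_ac)
  also have "\<dots> = of_nat d * ?s * (1 / of_nat d) * (1 / of_nat d) * cnj (H $$ (p, q))"
    by (simp only: s2 hadamard_entry_norm[OF assms(1)] assms(4-6))
  also have "\<dots> = ?s / (?s * ?s) * cnj (H $$ (p, q))"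
    unfolding s2 using d by simp
  finally show ?thesis using d by simp
qed

theorem mainTheorem6:
  fixes d n j :: nat and H :: "complex mat"
  assumes "1 \<le> d" and "3 \<le> n" and "1 < j" and "j < n"
    and "hadamard_mat d H"
    and "transpose_mat H = H"
    and "extended_calculus d H"
  shows "(\<exists>c. c \<noteq> 0 \<and>
      gateZ d {1..n} H j (j + 1) (gateZ d {1..n} H (j - 1) j
        (gate1 d {1..n} H j (cluster_chain d H [1..<n + 1]))) =
      scale_state c
        (tensor_state d ({1..n} - {j}) {j}
          (cluster_chain d H ([1..<j] @ [j + 1..<n + 1])) (plus_state d j))) \<and>
    tensor_state d ({1..n} - {j}) {j}
        (cluster_chain d H ([1..<j] @ [j + 1..<n + 1])) (plus_state d j) =
      superposition d {1..n}
        (\<lambda>a. (\<Prod>i = 1..j - 2. cnj (H $$ (a i, a (i + 1)))) *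
              cnj (H $$ (a (j - 1), a (j + 1))) *
              (\<Prod>i = j + 1..n - 1. cnj (H $$ (a i, a (i + 1)))))"
proof -
  let ?s = "complex_of_real (sqrt (real d))"
  let ?L = "\<lambda>a. \<Prod>i = 1..j - 2. cnj (H $$ (a i, a (i + 1)))"
  let ?R = "\<lambda>a. \<Prod>i = j + 1..n - 1. cnj (H $$ (a i, a (i + 1)))"
  let ?short = "\<lambda>a. ?L a * cnj (H $$ (a (j - 1), a (j + 1))) * ?R a"
  \<comment> \<open>Since \<open>1 < j\<close>, no subtraction is truncated here; for
    \<open>j = 2\<close> the left product is empty.\<close>
  have "Suc (j - 2) = j - 1" using assms by simp
  then have ivl: "{1..<j - 1} = {1..j - 2}" "{j + 1..<n + 1 - 1} = {j + 1..n - 1}"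
    using assms by auto
  have left: "(\<Prod>i<length [1..<j] - 1. cnj (H $$ (a ([1..<j] ! i), a ([1..<j] ! Suc i)))) = ?L a"
    for a :: label
    unfolding ivl(1)[symmetric] by (rule prod_consecutive_upt)
  have right: "(\<Prod>i<length [j + 1..<n + 1] - 1.
      cnj (H $$ (a ([j + 1..<n + 1] ! i), a ([j + 1..<n + 1] ! Suc i)))) = ?R a" for a :: label
    unfolding ivl(2)[symmetric] by (rule prod_consecutive_upt)
  have ends: "[1..<j] \<noteq> []" "[j + 1..<n + 1] \<noteq> []" "last [1..<j] = j - 1"
    "hd [j + 1..<n + 1] = j + 1"
    using assms by (simp_all add: last_upt hd_upt del: upt_Suc)
  have sets: "set ([1..<j] @ [j + 1..<n + 1]) = {1..n} - {j}" "set [1..<n + 1] = {1..n}"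
    "{1..n} - {j} \<union> {j} = {1..n}"
    using assms by auto
  have short: "cluster_chain d H ([1..<j] @ [j + 1..<n + 1]) =
      superposition d ({1..n} - {j}) ?short"
    unfolding cluster_chain_def sets(1)
    by (subst prod_consecutive_append[OF ends(1,2)]) (simp only: left right ends)
  \<comment> \<open>Isolating \<open>[j]\<close> exposes the only two bonds that involve qudit
    \<open>j\<close>.\<close>
  have "[1..<n + 1] = [1..<j] @ [j..<n + 1]"
    using upt_add_eq_append[of 1 j "n + 1 - j"] assms by simp
  also have "[j..<n + 1] = [j] @ [j + 1..<n + 1]"
    using assms by (simp add: upt_conv_Cons)
  finally have split: "[1..<n + 1] = [1..<j] @ [j] @ [j + 1..<n + 1]" .
  have long: "cluster_chain d H [1..<n + 1] = superposition d {1..n}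
      (\<lambda>a. ?L a * cnj (H $$ (a (j - 1), a j)) * (cnj (H $$ (a j, a (j + 1))) * ?R a))"
    unfolding cluster_chain_def sets(2)
  proof (rule superposition_cong)
    fix a :: label
    define g where "g = (\<lambda>u v. cnj (H $$ (a u, a v)))"
    have "[j] @ [j + 1..<n + 1] \<noteq> []" "[j] \<noteq> []" by simp_all
    note app = prod_consecutive_append[OF ends(1) this(1), of g]
      prod_consecutive_append[OF this(2) ends(2), of g]
    show "(\<Prod>i<length [1..<n + 1] - 1. cnj (H $$ (a ([1..<n + 1] ! i), a ([1..<n + 1] ! Suc i)))) =
        ?L a * cnj (H $$ (a (j - 1), a j)) * (cnj (H $$ (a j, a (j + 1))) * ?R a)"
      using app left[of a] right[of a] ends(3,4) unfolding split g_def
      by (simp add: mult.assoc del: upt_Suc)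
  qed
  have tensor: "tensor_state d ({1..n} - {j}) {j}
      (cluster_chain d H ([1..<j] @ [j + 1..<n + 1])) (plus_state d j) =
      superposition d {1..n} ?short"
    unfolding short plus_state_def
  \<comment> \<open>The shortened chain never reads qudit \<open>j\<close>, so restricting the label
    away from \<open>j\<close> changes nothing.\<close>
  proof (subst tensor_superposition, simp, simp, unfold sets(3), rule superposition_cong)
    fix a
    show "?short (restrict a ({1..n} - {j})) * 1 = ?short a"
      using assms by (auto intro!: arg_cong2[where f = "(*)"] prod.cong)
  qed
  have pt: "gateZ d {1..n} H j (j + 1) (gateZ d {1..n} H (j - 1) j
        (gate1 d {1..n} H j (cluster_chain d H [1..<n + 1]))) x =
      scale_state (1 / ?s) (superposition d {1..n} ?short) x" for x
  proof (cases "x \<in> labels d {1..n}")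
    case True
    have jn: "j \<in> {1..n}" "j - 1 \<in> {1..n}" "j + 1 \<in> {1..n}" using assms by auto
    have ne: "j - 1 \<noteq> j" using assms(3) by simp
    \<comment> \<open>\<open>?L\<close> reads only qudits up to \<open>j - 1\<close> and
      \<open>?R\<close> only those from \<open>j + 1\<close> on, so both leave the sum over
      \<open>r\<close>.\<close>
    have upd: "?L (x(j := r)) = ?L x" "?R (x(j := r)) = ?R x" for r
      by (auto intro!: prod.cong)
    have "(\<Sum>r<d. H $$ (x j, r) * cluster_chain d H [1..<n + 1] (x(j := r))) =
        (\<Sum>r<d. ?L x * ?R x *
          (H $$ (x j, r) * (cnj (H $$ (x (j - 1), r)) * cnj (H $$ (r, x (j + 1))))))"
    proof (rule sum.cong)
      fix r assume "r \<in> {..<d}"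
      then have "x(j := r) \<in> labels d {1..n}"
        using fun_upd_in_labels[OF True jn(1)] by simp
      then have "cluster_chain d H [1..<n + 1] (x(j := r)) =
          ?L x * cnj (H $$ (x (j - 1), r)) * (cnj (H $$ (r, x (j + 1))) * ?R x)"
        unfolding long superposition_apply[OF finite_atLeastAtMost] upd using ne by simp
      then show "H $$ (x j, r) * cluster_chain d H [1..<n + 1] (x(j := r)) = ?L x * ?R x *
          (H $$ (x j, r) * (cnj (H $$ (x (j - 1), r)) * cnj (H $$ (r, x (j + 1)))))"
        by (simp only: mult_ac)
    qed simp
    also have "\<dots> = ?L x * ?R x *
        (\<Sum>r<d. H $$ (x j, r) * (cnj (H $$ (x (j - 1), r)) * cnj (H $$ (r, x (j + 1)))))"
      by (simp only: sum_distrib_left)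
    finally have gate: "gate1 d {1..n} H j (cluster_chain d H [1..<n + 1]) x = ?L x * ?R x *
        (\<Sum>r<d. H $$ (x j, r) * (cnj (H $$ (x (j - 1), r)) * cnj (H $$ (r, x (j + 1)))))"
      using True jn(1) by (simp only: gate1_apply finite_atLeastAtMost if_True)
    have "gateZ d {1..n} H j (j + 1) (gateZ d {1..n} H (j - 1) j
        (gate1 d {1..n} H j (cluster_chain d H [1..<n + 1]))) x =
      ?L x * ?R x * (?s * cnj (H $$ (x j, x (j + 1))) * (?s * cnj (H $$ (x (j - 1), x j)) *
        (\<Sum>r<d. H $$ (x j, r) * (cnj (H $$ (x (j - 1), r)) * cnj (H $$ (r, x (j + 1)))))))"
      using True by (simp only: gateZ_apply gate finite_atLeastAtMost if_True mult_ac)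
    \<comment> \<open>The contraction is applied with \<open>p = x (j - 1)\<close>,
      \<open>q = x (j + 1)\<close> and \<open>t = x j\<close>.\<close>
    also have "\<dots> = ?L x * ?R x * (1 / ?s * cnj (H $$ (x (j - 1), x (j + 1))))"
      using label_less[OF True] jn
      by (simp only: extended_calculus_contract[OF assms(5-7)])
    also have "\<dots> = scale_state (1 / ?s) (superposition d {1..n} ?short) x"
      using True
      by (simp only: scale_state_def superposition_apply finite_atLeastAtMost if_True mult_ac)
    finally show ?thesis .
  next
    case False
    then show ?thesis
      by (simp add: gateZ_apply scale_state_def superposition_apply)
  qed
  show ?thesis
    \<comment> \<open>The scalar \<open>1 / ?s\<close> is nonzero because
      \<open>1 \<le> d\<close>.\<close>
    unfolding tensor using pt assms(1)
    by (intro conjI exI[of _ "1 / ?s"]) (auto simp: fun_eq_iff)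
qed

end
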